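(* Consider normalized three-particle pure states in $\mathbb{C}^d\otimes\mathbb{C}^d\otimes\mathbb{C}^d$. The geometric measure of partition rank two, $G_2$, is maximized by $|\psi\rangle$ (over all normalized states of $\mathbb{C}^d\otimes\mathbb{C}^d\otimes\mathbb{C}^d$) if and only if $|\psi\rangle$ is absolutely maximally entangled. In this case $$\Omega_2^2(\psi)=\sup_{|\eta\rangle\in\mathbb{P}_2}|\langle\eta|\psi\rangle|^2=\frac{2}{d}.$$
   Context: The three particles are called $A,B,C$, each with Hilbert space $\mathbb{C}^d$, where $d$ is the local dimension. The bipartitions are $\mathcal{P}=\{A|BC,\;B|AC,\;C|AB\}$. A vector is separable with respect to a bipartition $X|YZ$ if it is of the form $|\alpha\rangle_X\otimes|\beta\rangle_{YZ}$. The partition rank of a vector $|\eta\rangle$ is the smallest number $r$ such that $|\eta\rangle=\sum_{i=1}^{r}|\nu_i\rangle$, where each (not necessarily normalized) $|\nu_i\rangle$ is separable with respect to at least one bipartition in $\mathcal{P}$ (which may depend on $i$). $\mathbb{P}_k$ denotes the set of all normalized vectors with partition rank at most $k$. For a normalized state $|\psi\rangle$, put $\Omega_k^2(\psi)=\sup_{|\eta\rangle\in\mathbb{P}_k}|\langle\eta|\psi\rangle|^2$. The geometric measure of partition rank $k$ is $G_k(\psi)=1-\Omega_k^2(\psi)$. A normalized three-particle state in $(\mathbb{C}^d)^{\otimes 3}$ is absolutely maximally entangled (AME) if all three of its one-particle reduced density matrices are maximally mixed, i.e. equal to $\mathbb{1}/d$, where $\mathbb{1}$ is the identity on $\mathbb{C}^d$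 (equivalently, for each of the three bipartitions all $d$ Schmidt coefficients equal $1/\sqrt{d}$).
   Formalization: The equivalence is asserted only for d ≠ 2 (at d = 2, G_2 vanishes identically, so product states also maximize it without being AME), and the formula Ω_2² = 2/d only for d ≠ 1 (at d = 1 the value is 1). *)

theory Defs
  imports "HOL-Analysis.Analysis"
begin

text \<open>
  The particles A, B, C all have Hilbert space \<open>complex ^ 'd\<close>, with local dimension
  \<open>CARD('d)\<close>. Vectors of the threefold tensor product are given by their amplitudes in
  the product basis, indexed by \<open>'d \<times> 'd \<times> 'd\<close> in the order (A, B, C). The library norm
  on \<open>complex ^ 'n\<close> is the Hilbert space norm.
\<close>

type_synonym 'd state = "complex ^ ('d \<times> 'd \<times> 'd)"

definition braket :: "complex ^ 'n::finite \<Rightarrow> complex ^ 'n \<Rightarrow> complex" where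
  "braket \<eta> \<psi> = (\<Sum>i\<in>UNIV. cnj (\<eta> $ i) * \<psi> $ i)"

definition normalized :: "complex ^ 'n::finite \<Rightarrow> bool" where
  "normalized \<psi> \<longleftrightarrow> norm \<psi> = 1"

datatype bipartition = A_BC | B_AC | C_AB

primrec bitensor ::
  "bipartition \<Rightarrow> complex ^ 'd::finite \<Rightarrow> complex ^ ('d \<times> 'd) \<Rightarrow> 'd state" where
  "bitensor A_BC \<alpha> \<beta> = vec_lambda (\<lambda>(a, b, c). \<alpha> $ a * \<beta> $ (b, c))"
| "bitensor B_AC \<alpha> \<beta> = vec_lambda (\<lambda>(a, b, c). \<alpha> $ b * \<beta> $ (a, c))"
| "bitensor C_AB \<alpha> \<beta> = vec_lambda (\<lambda>(a, b, c). \<alpha> $ c * \<beta> $ (a, b))"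

definition separable_wrt :: "bipartition \<Rightarrow> 'd::finite state \<Rightarrow> bool" where
  "separable_wrt P \<nu> \<longleftrightarrow> (\<exists>\<alpha> \<beta>. \<nu> = bitensor P \<alpha> \<beta>)"

definition partition_rank :: "'d::finite state \<Rightarrow> nat" where
  "partition_rank \<eta> =
     (LEAST r. \<exists>\<nu> :: nat \<Rightarrow> 'd state.
        (\<forall>i<r. \<exists>P. separable_wrt P (\<nu> i)) \<and> \<eta> = (\<Sum>i<r. \<nu> i))"

definition rank_states :: "nat \<Rightarrow> 'd::finite state set" where
  "rank_states k = {\<eta>. normalized \<eta> \<and> partition_rank \<eta> \<le> k}"

text \<open>
  For normalized \<open>\<psi>\<close> and \<open>k \<ge> 1\<close> the supremum below is over a nonempty set
  bounded by 1, so the real-valued supremum is the intended one.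
\<close>

definition Omega_sq :: "nat \<Rightarrow> 'd::finite state \<Rightarrow> real" where
  "Omega_sq k \<psi> = (SUP \<eta>\<in>rank_states k. (cmod (braket \<eta> \<psi>))\<^sup>2)"

definition geometric_measure :: "nat \<Rightarrow> 'd::finite state \<Rightarrow> real" where
  "geometric_measure k \<psi> = 1 - Omega_sq k \<psi>"

definition density :: "complex ^ 'n::finite \<Rightarrow> complex ^ 'n ^ 'n" where
  "density \<psi> = (\<chi> i j. \<psi> $ i * cnj (\<psi> $ j))"

definition reduced_A :: "'d::finite state \<Rightarrow> complex ^ 'd ^ 'd" where
  "reduced_A \<psi> = (\<chi> i j. \<Sum>b\<in>UNIV. \<Sum>c\<in>UNIV. density \<psi> $ (i, b, c) $ (j, b, c))"

definition reduced_B :: "'d::finite state \<Rightarrow> complex ^ 'd ^ 'd" where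
  "reduced_B \<psi> = (\<chi> i j. \<Sum>a\<in>UNIV. \<Sum>c\<in>UNIV. density \<psi> $ (a, i, c) $ (a, j, c))"

definition reduced_C :: "'d::finite state \<Rightarrow> complex ^ 'd ^ 'd" where
  "reduced_C \<psi> = (\<chi> i j. \<Sum>a\<in>UNIV. \<Sum>b\<in>UNIV. density \<psi> $ (a, b, i) $ (a, b, j))"

definition maximally_mixed :: "complex ^ 'd::finite ^ 'd \<Rightarrow> bool" where
  "maximally_mixed \<rho> \<longleftrightarrow> \<rho> = mat (1 / of_nat CARD('d))"

definition AME :: "'d::finite state \<Rightarrow> bool" where
  "AME \<psi> \<longleftrightarrow> normalized \<psi> \<and> maximally_mixed (reduced_A \<psi>) \<and>
     maximally_mixed (reduced_B \<psi>) \<and> maximally_mixed (reduced_C \<psi>)"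

text \<open>
  In local dimension 2 every vector is the sum of two vectors separable with respect to
  \<open>A_BC\<close>, so \<open>geometric_measure 2\<close> vanishes identically and every state, whether AME or
  not, maximizes it. In local dimension 1, \<open>Omega_sq 2\<close> is 1 rather than 2.
\<close>

definition maximizes_G2 :: "'d::finite state \<Rightarrow> bool" where
  "maximizes_G2 \<psi> \<longleftrightarrow> normalized \<psi> \<and>
     (\<forall>\<phi> :: 'd state. normalized \<phi> \<longrightarrow> geometric_measure 2 \<phi> \<le> geometric_measure 2 \<psi>)"

end

theory Submission
  imports Defs
begin

text \<open>
  Upper bound for AME states: if \<open>\<eta> = \<nu> + \<mu>\<close> with \<open>\<nu> = \<alpha> \<otimes> \<beta>\<close>, \<open>\<alpha>\<close> a unit vector, move the
  component of \<open>\<mu>\<close> along \<open>\<alpha>\<close> into \<open>\<nu>\<close>. Both summands stay separable and become orthogonal. A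
  separable vector overlaps with an AME state by at most its norm over \<open>\<surd>d\<close>, so
  \<open>|\<langle>\<eta>|\<psi>\<rangle>|\<^sup>2 \<le> (\<parallel>\<nu>\<parallel> + \<parallel>\<mu>\<parallel>)\<^sup>2 / d \<le> 2 / d\<close>.

  Lower bound: let \<open>f(\<alpha>)\<close> be the squared norm of the partial inner product \<open>\<langle>\<alpha>|\<psi>\<rangle>\<close>. Then
  \<open>f(\<alpha>) + f(\<gamma>) \<le> \<Omega>\<^sub>2\<^sup>2\<close> for orthonormal \<open>\<alpha>, \<gamma>\<close>, and \<open>f\<close> sums to 1 over an orthonormal basis;
  averaging over pairs gives \<open>\<Omega>\<^sub>2\<^sup>2 \<ge> 2 / d\<close>. If equality holds and \<open>d \<ge> 3\<close>, then all diagonal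
  entries \<open>f(e\<^sub>i)\<close> of the reduced density matrix are \<open>1 / d\<close>. Pairing \<open>(e\<^sub>i + \<omega> e\<^sub>j) / \<surd>2\<close> with
  a third \<open>e\<^sub>k\<close> gives \<open>Re (\<omega> \<rho>\<^sub>i\<^sub>j) \<le> 0\<close> for every phase \<open>\<omega>\<close>, so \<open>\<rho>\<^sub>i\<^sub>j = 0\<close>.
\<close>

section \<open>The bracket\<close>

lemma braket_add_left: "braket (x + y) z = braket x z + braket y z"
  by (simp add: braket_def ring_distribs sum.distrib)

lemma braket_add_right: "braket x (y + z) = braket x y + braket x z"
  by (simp add: braket_def ring_distribs sum.distrib)

lemma braket_scaleR_left: "braket (c *\<^sub>R x) y = of_real c * braket x y"
  by (simp add: braket_def sum_distrib_left scaleR_conv_of_real[where 'a = complex] mult.assoc)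

lemma braket_commute: "braket y x = cnj (braket x y)"
  by (simp add: braket_def mult.commute)

lemma norm_sq_vec: "(norm x)\<^sup>2 = (\<Sum>i\<in>UNIV. (cmod (x $ i))\<^sup>2)" for x :: "complex ^ 'n::finite"
  by (simp add: norm_vec_def L2_set_def sum_nonneg)

lemma braket_self: "braket x x = of_real ((norm x)\<^sup>2)"
  unfolding norm_sq_vec of_real_sum braket_def
  by (intro sum.cong refl) (metis complex_norm_square mult.commute of_real_power)

lemma cmod_braket_le: "cmod (braket x y) \<le> norm x * norm y"
proof -
  have "cmod (braket x y) \<le> (\<Sum>i\<in>UNIV. \<bar>cmod (x $ i)\<bar> * \<bar>cmod (y $ i)\<bar>)"
    unfolding braket_def by (rule order_trans[OF norm_sum]) (simp add: norm_mult)
  also have "\<dots> \<le> norm x * norm y"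
    unfolding norm_vec_def by (rule L2_set_mult_ineq)
  finally show ?thesis .
qed

lemma norm_add_sq_orthogonal:
  assumes "braket x y = 0"
  shows "(norm (x + y))\<^sup>2 = (norm x)\<^sup>2 + (norm y)\<^sup>2"
proof -
  have "braket y x = 0" using assms braket_commute[of y x] by simp
  then have "complex_of_real ((norm (x + y))\<^sup>2) = of_real ((norm x)\<^sup>2 + (norm y)\<^sup>2)"
    unfolding braket_self[symmetric] of_real_add
    by (simp add: braket_add_left braket_add_right assms)
  then show ?thesis unfolding of_real_eq_iff .
qed

lemma axis_mult:
  "axis i 1 $ x * z = (if x = i then z else 0)"
  "cnj (axis i 1 $ x) * z = (if x = i then z else 0)"
  by (simp_all add: axis_def)

lemma braket_axis: "braket (axis i 1) x = x $ i"
  by (simp add: braket_def axis_mult)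

section \<open>Bipartitions\<close>

text \<open>The basis index whose singled-out particle of the bipartition is in state \<open>x\<close> while the
  other two are in the joint state \<open>y\<close>; it treats the three bipartitions uniformly.\<close>

primrec place :: "bipartition \<Rightarrow> 'd \<Rightarrow> 'd \<times> 'd \<Rightarrow> 'd \<times> 'd \<times> 'd" where
  "place A_BC x y = (x, fst y, snd y)"
| "place B_AC x y = (fst y, x, snd y)"
| "place C_AB x y = (fst y, snd y, x)"

lemma bij_place: "bij (\<lambda>(x, y). place P x y)"
  by (cases P) (auto simp: bij_def inj_def surj_def)

lemma place_exhaust: obtains x y where "i = place P x y"
  using bij_place[of P] by (metis bij_pointE case_prod_conv old.prod.exhaust)

lemma sum_place: "(\<Sum>i\<in>UNIV. f i) = (\<Sum>x\<in>UNIV. \<Sum>y\<in>UNIV. f (place P x y))"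
  for f :: "'d::finite \<times> 'd \<times> 'd \<Rightarrow> 'a::comm_monoid_add"
proof -
  have "(\<Sum>i\<in>UNIV. f i) = (\<Sum>z\<in>UNIV. f (case z of (x, y) \<Rightarrow> place P x y))"
    by (rule sum.reindex_bij_betw[symmetric]) (rule bij_place)
  also have "\<dots> = (\<Sum>x\<in>UNIV. \<Sum>y\<in>UNIV. f (place P x y))"
    by (simp add: sum.cartesian_product case_prod_beta)
  finally show ?thesis .
qed

text \<open>Extensionality in the coordinates of a freely chosen \<open>P\<close>, so that
  \<open>bitensor_place\<close> can rewrite the entries.\<close>

lemma state_eq_iff: "\<nu> = \<mu> \<longleftrightarrow> (\<forall>x y. \<nu> $ place P x y = \<mu> $ place P x y)"
  by (metis place_exhaust vec_eq_iff)

lemma bitensor_place [simp]: "bitensor P \<alpha> \<beta> $ place P x y = \<alpha> $ x * \<beta> $ y"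
  by (cases P; cases y) simp_all

lemma bitensor_add_right: "bitensor P \<alpha> (\<beta> + \<gamma>) = bitensor P \<alpha> \<beta> + bitensor P \<alpha> \<gamma>"
  by (simp add: state_eq_iff[of _ _ P] ring_distribs)

lemma bitensor_scaleR: "bitensor P (c *\<^sub>R \<alpha>) \<beta> = c *\<^sub>R bitensor P \<alpha> \<beta>"
  by (simp add: state_eq_iff[of _ _ P])

lemma bitensor_scaleR_right: "bitensor P \<alpha> (c *\<^sub>R \<beta>) = c *\<^sub>R bitensor P \<alpha> \<beta>"
  by (simp add: state_eq_iff[of _ _ P])

lemma separable_wrt_scaleR:
  "separable_wrt P \<nu> \<Longrightarrow> separable_wrt P (c *\<^sub>R \<nu>)"
  unfolding separable_wrt_def by (metis bitensor_scaleR)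

lemma separable_wrt_zero: "separable_wrt P 0"
  unfolding separable_wrt_def by (metis bitensor_scaleR scaleR_zero_left)

lemma norm_sq_bitensor: "(norm (bitensor P \<alpha> \<beta>))\<^sup>2 = (norm \<alpha>)\<^sup>2 * (norm \<beta>)\<^sup>2"
  by (simp add: norm_sq_vec[of "bitensor P \<alpha> \<beta>"] sum_place[of _ P] norm_mult power_mult_distrib
      norm_sq_vec[of \<alpha>] norm_sq_vec[of \<beta>] sum_product)

text \<open>The partial inner product \<open>\<langle>\<alpha>|\<psi>\<rangle>\<close> over the singled-out particle.\<close>

definition contract ::
  "bipartition \<Rightarrow> complex ^ 'd::finite \<Rightarrow> 'd state \<Rightarrow> complex ^ ('d \<times> 'd)" where
  "contract P \<alpha> \<psi> = (\<chi> y. \<Sum>x\<in>UNIV. cnj (\<alpha> $ x) * \<psi> $ place P x y)"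

text \<open>Contraction with \<alpha> is the adjoint of tensoring with \<alpha>; overlaps with
  separable vectors thus become inner products of two-particle vectors.\<close>

lemma braket_bitensor: "braket (bitensor P \<alpha> \<beta>) \<psi> = braket \<beta> (contract P \<alpha> \<psi>)"
proof -
  have "braket (bitensor P \<alpha> \<beta>) \<psi> =
      (\<Sum>x\<in>UNIV. \<Sum>y\<in>UNIV. cnj (\<beta> $ y) * (cnj (\<alpha> $ x) * \<psi> $ place P x y))"
    by (simp add: braket_def sum_place[of _ P] mult_ac)
  also have "\<dots> = braket \<beta> (contract P \<alpha> \<psi>)"
    by (subst sum.swap) (simp add: braket_def contract_def sum_distrib_left)
  finally show ?thesis .
qed

lemma contract_bitensor: "contract P \<alpha> (bitensor P \<gamma> \<beta>) = braket \<alpha> \<gamma> *s \<beta>"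
  by (simp add: contract_def vec_eq_iff braket_def sum_distrib_right mult.assoc)

lemma contract_diff: "contract P \<alpha> (\<phi> - \<psi>) = contract P \<alpha> \<phi> - contract P \<alpha> \<psi>"
  by (simp add: contract_def vec_eq_iff right_diff_distrib sum_subtractf)

section \<open>Reduced density matrices and norms of contractions\<close>

definition reduced :: "bipartition \<Rightarrow> 'd::finite state \<Rightarrow> complex ^ 'd ^ 'd" where
  "reduced P \<psi> = (\<chi> i j. \<Sum>y\<in>UNIV. \<psi> $ place P i y * cnj (\<psi> $ place P j y))"

lemma reduced_eqs:
  "reduced_A \<psi> = reduced A_BC \<psi>" "reduced_B \<psi> = reduced B_AC \<psi>" "reduced_C \<psi> = reduced C_AB \<psi>"
  by (simp_all add: reduced_A_def reduced_B_def reduced_C_def reduced_def density_def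
      sum.cartesian_product case_prod_beta)

lemma AME_iff: "AME \<psi> \<longleftrightarrow> normalized \<psi> \<and> (\<forall>P. maximally_mixed (reduced P \<psi>))"
  unfolding AME_def reduced_eqs by (metis bipartition.exhaust)

text \<open>The right side is the quadratic form of the reduced density matrix at \<alpha>; this
  links the values f(\<alpha>) to its entries.\<close>

lemma norm_sq_contract:
  "of_real ((norm (contract P \<alpha> \<psi>))\<^sup>2) =
    (\<Sum>i\<in>UNIV. \<Sum>j\<in>UNIV. cnj (\<alpha> $ i) * \<alpha> $ j * reduced P \<psi> $ i $ j)"
proof -
  have "of_real ((norm (contract P \<alpha> \<psi>))\<^sup>2) =
      (\<Sum>y\<in>UNIV. (\<Sum>i\<in>UNIV. cnj (\<alpha> $ i) * \<psi> $ place P i y) *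
        (\<Sum>j\<in>UNIV. \<alpha> $ j * cnj (\<psi> $ place P j y)))"
    unfolding braket_self[symmetric] by (simp add: braket_def contract_def mult.commute)
  also have "\<dots> = (\<Sum>y\<in>UNIV. \<Sum>i\<in>UNIV. \<Sum>j\<in>UNIV.
      cnj (\<alpha> $ i) * \<alpha> $ j * (\<psi> $ place P i y * cnj (\<psi> $ place P j y)))"
    unfolding sum_product by (simp add: mult_ac)
  also have "\<dots> = (\<Sum>i\<in>UNIV. \<Sum>y\<in>UNIV. \<Sum>j\<in>UNIV.
      cnj (\<alpha> $ i) * \<alpha> $ j * (\<psi> $ place P i y * cnj (\<psi> $ place P j y)))"
    by (rule sum.swap)
  also have "\<dots> = (\<Sum>i\<in>UNIV. \<Sum>j\<in>UNIV. cnj (\<alpha> $ i) * \<alpha> $ j * reduced P \<psi> $ i $ j)"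
    by (subst sum.swap) (simp add: reduced_def sum_distrib_left)
  finally show ?thesis .
qed

lemma norm_sq_contract_mixed:
  assumes "maximally_mixed (reduced P (\<psi> :: 'd::finite state))"
  shows "(norm (contract P \<alpha> \<psi>))\<^sup>2 = (norm \<alpha>)\<^sup>2 / CARD('d)"
proof -
  have *: "reduced P \<psi> $ i $ j = (if i = j then 1 / of_nat CARD('d) else 0)" for i j
    using assms by (simp add: maximally_mixed_def mat_def)
  have "complex_of_real ((norm (contract P \<alpha> \<psi>))\<^sup>2) = (\<Sum>i\<in>UNIV. cnj (\<alpha> $ i) * \<alpha> $ i / of_nat CARD('d))"
    unfolding norm_sq_contract * by (simp add: if_distrib cong: if_cong)
  also have "\<dots> = braket \<alpha> \<alpha> / of_nat CARD('d)"
    by (simp add: braket_def sum_divide_distrib)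
  also have "\<dots> = of_real ((norm \<alpha>)\<^sup>2 / CARD('d))"
    unfolding braket_self by simp
  finally show ?thesis unfolding of_real_eq_iff .
qed

text \<open>Cauchy-Schwarz on the other two particles, where contraction shrinks the norm of
  \<alpha> by exactly the root of the dimension.\<close>

lemma braket_separable_mixed:
  assumes "maximally_mixed (reduced P (\<psi> :: 'd::finite state))" and "separable_wrt P \<nu>"
  shows "cmod (braket \<nu> \<psi>) \<le> norm \<nu> / sqrt CARD('d)"
proof -
  obtain \<alpha> \<beta> where \<nu>: "\<nu> = bitensor P \<alpha> \<beta>" using assms by (auto simp: separable_wrt_def)
  have "norm (contract P \<alpha> \<psi>) = sqrt ((norm \<alpha>)\<^sup>2 / CARD('d))"
    by (metis assms(1) norm_ge_zero norm_sq_contract_mixed real_sqrt_unique)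
  then have "norm (contract P \<alpha> \<psi>) = norm \<alpha> / sqrt CARD('d)"
    by (simp add: real_sqrt_divide)
  moreover have "norm \<nu> = norm \<alpha> * norm \<beta>"
    using norm_sq_bitensor[of P \<alpha> \<beta>] unfolding \<nu>
    by (metis mult_nonneg_nonneg norm_ge_zero power2_eq_imp_eq power_mult_distrib)
  ultimately show ?thesis
    using cmod_braket_le[of \<beta> "contract P \<alpha> \<psi>"] by (simp add: \<nu> braket_bitensor mult.commute)
qed

section \<open>Partition rank two\<close>

text \<open>Expanding in a basis of particle A yields such a sum. Hence the minimum in
  \<open>partition_rank\<close> is attained.\<close>

lemma separable_decomposition_exists:
  fixes \<eta> :: "'d::finite state"
  shows "\<exists>(r :: nat) \<nu>. (\<forall>i<r. \<exists>P. separable_wrt P (\<nu> i)) \<and> \<eta> = (\<Sum>i<r. \<nu> i)"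
proof -
  obtain h where h: "bij_betw h {..<CARD('d)} (UNIV :: 'd set)"
    using ex_bij_betw_nat_finite[of "UNIV :: 'd set"] by (auto simp: atLeast0LessThan)
  define \<mu> where "\<mu> x = bitensor A_BC (axis x 1) (\<chi> y. \<eta> $ place A_BC x y)" for x
  have "\<eta> = (\<Sum>x\<in>UNIV. \<mu> x)"
    by (simp add: state_eq_iff[of _ _ A_BC] \<mu>_def axis_mult
        del: place.simps bitensor.simps)
  also have "\<dots> = (\<Sum>i<CARD('d). \<mu> (h i))"
    by (rule sum.reindex_bij_betw[OF h, symmetric])
  finally have "\<eta> = (\<Sum>i<CARD('d). \<mu> (h i))" .
  moreover have "separable_wrt A_BC (\<mu> x)" for x
    unfolding \<mu>_def separable_wrt_def by (intro exI) (rule refl)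
  ultimately show ?thesis
    by - (rule exI[of _ "CARD('d)"], rule exI[of _ "\<lambda>i. \<mu> (h i)"], blast)
qed

lemma rank_states_2_iff:
  "\<eta> \<in> rank_states 2 \<longleftrightarrow> normalized \<eta> \<and>
    (\<exists>\<nu> \<mu> P Q. separable_wrt P \<nu> \<and> separable_wrt Q \<mu> \<and> \<eta> = \<nu> + \<mu>)" (is "?L \<longleftrightarrow> ?R")
proof
  assume L: ?L
  define D where "D r \<longleftrightarrow> (\<exists>\<nu> :: nat \<Rightarrow> 'a state.
        (\<forall>i<r. \<exists>P. separable_wrt P (\<nu> i)) \<and> \<eta> = (\<Sum>i<r. \<nu> i))" for r
  define r where "r = partition_rank \<eta>"
  have "D r" unfolding r_def partition_rank_def D_def[symmetric]
    by (rule LeastI_ex) (use separable_decomposition_exists[of \<eta>] in \<open>auto simp: D_def\<close>)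
  then obtain \<nu> where \<nu>: "\<forall>i<r. \<exists>P. separable_wrt P (\<nu> i)" "\<eta> = (\<Sum>i<r. \<nu> i)"
    unfolding D_def by blast
  have r: "r \<le> 2" and n: "normalized \<eta>" using L by (auto simp: rank_states_def r_def)
  \<comment> \<open>A decomposition with fewer than two terms is padded with zero vectors, which are
    separable.\<close>
  define \<mu> where "\<mu> i = (if i < r then \<nu> i else 0)" for i
  have "\<exists>P. separable_wrt P (\<mu> i)" for i using \<nu>(1) separable_wrt_zero by (auto simp: \<mu>_def)
  moreover have "\<eta> = \<mu> 0 + \<mu> (Suc 0)"
  proof -
    have "(\<Sum>i<r. \<nu> i) = (\<Sum>i<2. \<mu> i)"
      using r by (intro sum.mono_neutral_cong_left) (auto simp: \<mu>_def)
    then show ?thesis by (simp add: \<nu>(2) numeral_2_eq_2)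
  qed
  ultimately show ?R using n by blast
next
  assume R: ?R
  then obtain \<nu> \<mu> P Q where *: "separable_wrt P \<nu>" "separable_wrt Q \<mu>" "\<eta> = \<nu> + \<mu>" by blast
  have "partition_rank \<eta> \<le> 2" unfolding partition_rank_def
    by (rule Least_le, rule exI[of _ "\<lambda>i. if i = 0 then \<nu> else \<mu>"])
      (use * in \<open>auto simp: numeral_2_eq_2\<close>)
  then show ?L using R by (simp add: rank_states_def)
qed

lemma separable_unit_factor:
  assumes "separable_wrt P \<nu>"
  obtains \<alpha> \<beta> where "norm \<alpha> = 1" "\<nu> = bitensor P \<alpha> \<beta>"
proof -
  obtain \<alpha> \<beta> where \<nu>: "\<nu> = bitensor P \<alpha> \<beta>" using assms by (auto simp: separable_wrt_def)
  show thesis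
  proof (cases "\<alpha> = 0")
    case True
    \<comment> \<open>Here \<nu> is zero, so any unit vector serves, paired with the zero
      vector.\<close>
    have "norm (axis undefined 1 :: complex ^ 'a) = 1" by simp
    moreover have "\<nu> = bitensor P (axis undefined 1) 0"
      by (simp add: \<nu> True state_eq_iff[of _ _ P])
    ultimately show thesis by (rule that)
  next
    case False
    have "norm (inverse (norm \<alpha>) *\<^sub>R \<alpha>) = 1" using False by simp
    moreover have "\<nu> = bitensor P (inverse (norm \<alpha>) *\<^sub>R \<alpha>) (norm \<alpha> *\<^sub>R \<beta>)"
      using False by (simp add: \<nu> bitensor_scaleR bitensor_scaleR_right)
    ultimately show thesis by (rule that)
  qed
qed

text \<open>Projecting one particle preserves separability for every bipartition: the projection
  acts within a single tensor factor.\<close>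

lemma separable_wrt_project:
  assumes "separable_wrt Q \<mu>"
  shows "separable_wrt Q (\<mu> - bitensor P \<alpha> (contract P \<alpha> \<mu>))"
proof -
  obtain \<gamma> \<delta> where \<mu>: "\<mu> = bitensor Q \<gamma> \<delta>" using assms by (auto simp: separable_wrt_def)
  \<comment> \<open>For \<open>P\<close> different from \<open>Q\<close>, the particle singled out
    by \<open>P\<close> is the first or the second of the pair left by \<open>Q\<close>; \<delta>1
    and \<delta>2 remove the \<alpha> component from that slot of \<delta>.\<close>
  define \<delta>1 where "\<delta>1 = (\<chi> y. \<delta> $ y - \<alpha> $ fst y * (\<Sum>x\<in>UNIV. cnj (\<alpha> $ x) * \<delta> $ (x, snd y)))"
  define \<delta>2 where "\<delta>2 = (\<chi> y. \<delta> $ y - \<alpha> $ snd y * (\<Sum>x\<in>UNIV. cnj (\<alpha> $ x) * \<delta> $ (fst y, x)))"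
  have eq: "separable_wrt Q \<nu>" if "\<nu> = bitensor Q \<gamma>' \<delta>'" for \<nu> :: "'a state" and \<gamma>' \<delta>'
    using that by (auto simp: separable_wrt_def)
  have pull: "(\<Sum>x\<in>UNIV. cnj (\<alpha> $ x) * (c * h x)) = c * (\<Sum>x\<in>UNIV. cnj (\<alpha> $ x) * h x)" for c h
    by (simp add: sum_distrib_left mult.left_commute)
  have comm: "\<alpha> $ i * (\<gamma> $ j * s) = \<gamma> $ j * (\<alpha> $ i * s)" for i j s
    by (rule mult.left_commute)
  consider "P = Q" | "(P, Q) \<in> {(A_BC, B_AC), (A_BC, C_AB), (B_AC, A_BC)}"
    | "(P, Q) \<in> {(B_AC, C_AB), (C_AB, A_BC), (C_AB, B_AC)}"
    by (cases P; cases Q) auto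
  then show ?thesis
  proof cases
    case 1
    show ?thesis
      by (rule eq[of _ "\<gamma> - braket \<alpha> \<gamma> *s \<alpha>" \<delta>])
        (simp add: 1 \<mu> contract_bitensor state_eq_iff[of _ _ Q] algebra_simps)
  next
    case 2
    then show ?thesis
      by (intro eq[of _ \<gamma> \<delta>1])
        (auto simp: \<mu> \<delta>1_def contract_def vec_eq_iff pull comm right_diff_distrib)
  next
    case 3
    then show ?thesis
      by (intro eq[of _ \<gamma> \<delta>2])
        (auto simp: \<mu> \<delta>2_def contract_def vec_eq_iff pull comm right_diff_distrib)
  qed
qed

lemma orthogonal_separable_decomposition:
  assumes "separable_wrt P \<nu>" and "separable_wrt Q \<mu>"
  obtains \<nu>' \<mu>' where "separable_wrt P \<nu>'" "separable_wrt Q \<mu>'" "\<nu> + \<mu> = \<nu>' + \<mu>'"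
    "braket \<nu>' \<mu>' = 0"
proof -
  obtain \<alpha> \<beta> where \<alpha>: "norm \<alpha> = 1" and \<nu>: "\<nu> = bitensor P \<alpha> \<beta>"
    using assms(1) by (rule separable_unit_factor)
  define \<kappa> where "\<kappa> = contract P \<alpha> \<mu>"
  \<comment> \<open>As \<alpha> is a unit vector, the remainder has no \<alpha> component, so it is
    orthogonal to every product with \<alpha>.\<close>
  have "contract P \<alpha> (\<mu> - bitensor P \<alpha> \<kappa>) = 0"
    by (simp add: contract_diff contract_bitensor braket_self \<alpha> \<kappa>_def)
  then have "braket (bitensor P \<alpha> (\<beta> + \<kappa>)) (\<mu> - bitensor P \<alpha> \<kappa>) = 0"
    by (simp add: braket_bitensor) (simp add: braket_def)
  moreover have "\<nu> + \<mu> = bitensor P \<alpha> (\<beta> + \<kappa>) + (\<mu> - bitensor P \<alpha> \<kappa>)"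
    by (simp add: \<nu> bitensor_add_right)
  moreover have "separable_wrt P (bitensor P \<alpha> (\<beta> + \<kappa>))"
    by (auto simp: separable_wrt_def)
  moreover have "separable_wrt Q (\<mu> - bitensor P \<alpha> \<kappa>)"
    unfolding \<kappa>_def by (rule separable_wrt_project[OF assms(2)])
  ultimately show thesis by (intro that)
qed

lemma AME_overlap_le:
  assumes "AME (\<psi> :: 'd::finite state)" and "\<eta> \<in> rank_states 2"
  shows "(cmod (braket \<eta> \<psi>))\<^sup>2 \<le> 2 / CARD('d)"
proof -
  obtain \<nu>0 \<mu>0 P Q where *: "separable_wrt P \<nu>0" "separable_wrt Q \<mu>0" "\<eta> = \<nu>0 + \<mu>0"
    and n: "norm \<eta> = 1"
    using assms(2) by (auto simp: rank_states_2_iff normalized_def)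
  obtain \<nu> \<mu> where \<nu>: "separable_wrt P \<nu>" "separable_wrt Q \<mu>" "\<eta> = \<nu> + \<mu>"
    and orth: "braket \<nu> \<mu> = 0"
    using orthogonal_separable_decomposition[OF *(1,2)] *(3) by metis
  have mixed: "maximally_mixed (reduced R \<psi>)" for R using assms(1) by (simp add: AME_iff)
  have "cmod (braket \<eta> \<psi>) \<le> cmod (braket \<nu> \<psi>) + cmod (braket \<mu> \<psi>)"
    by (simp add: \<nu>(3) braket_add_left norm_triangle_ineq)
  also have "\<dots> \<le> (norm \<nu> + norm \<mu>) / sqrt CARD('d)"
    using braket_separable_mixed[OF mixed \<nu>(1)] braket_separable_mixed[OF mixed \<nu>(2)]
    by (simp add: add_divide_distrib)
  finally have "(cmod (braket \<eta> \<psi>))\<^sup>2 \<le> ((norm \<nu> + norm \<mu>) / sqrt CARD('d))\<^sup>2"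
    by (rule power_mono) simp
  also have "\<dots> = (norm \<nu> + norm \<mu>)\<^sup>2 / CARD('d)" by (simp add: power_divide)
  also have "\<dots> \<le> (2 * (norm \<eta>)\<^sup>2) / CARD('d)"
  proof (rule divide_right_mono)
    \<comment> \<open>Pythagoras, combined with the inequality
      \<open>(x + y)^2 <= 2 * (x^2 + y^2)\<close>.\<close>
    have "(norm \<eta>)\<^sup>2 = (norm \<nu>)\<^sup>2 + (norm \<mu>)\<^sup>2"
      unfolding \<nu>(3) by (rule norm_add_sq_orthogonal[OF orth])
    then show "(norm \<nu> + norm \<mu>)\<^sup>2 \<le> 2 * (norm \<eta>)\<^sup>2"
      using zero_le_power2[of "norm \<nu> - norm \<mu>"] by (simp add: power2_sum power2_diff)
  qed simp
  finally show ?thesis using n by simp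
qed

section \<open>Bounds for the supremum\<close>

lemma rank_states_2_nonempty: "(rank_states 2 :: 'd::finite state set) \<noteq> {}"
proof -
  define \<nu> :: "'d state" where
    "\<nu> = bitensor A_BC (axis undefined 1) (axis (undefined, undefined) 1)"
  have "(norm \<nu>)\<^sup>2 = 1" unfolding \<nu>_def norm_sq_bitensor by simp
  then have "normalized \<nu>"
    by (metis norm_ge_zero normalized_def power2_eq_1_iff neg_0_le_iff_le not_one_le_zero)
  moreover have "separable_wrt A_BC \<nu>" by (auto simp: separable_wrt_def \<nu>_def)
  ultimately have "\<nu> \<in> rank_states 2"
    unfolding rank_states_2_iff using separable_wrt_zero[of A_BC] by (metis add_0_right)
  then show ?thesis by blast
qed

lemma overlap_le_1:
  assumes "normalized \<psi>" "\<eta> \<in> rank_states k"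
  shows "(cmod (braket \<eta> \<psi>))\<^sup>2 \<le> 1"
  using cmod_braket_le[of \<eta> \<psi>] assms
  by (simp add: normalized_def rank_states_def power_le_one)

lemma Omega_sq_upper:
  assumes "normalized \<psi>" "\<eta> \<in> rank_states k"
  shows "(cmod (braket \<eta> \<psi>))\<^sup>2 \<le> Omega_sq k \<psi>"
  unfolding Omega_sq_def
  by (rule cSUP_upper[OF assms(2)]) (rule bdd_aboveI2[OF overlap_le_1[OF assms(1)]])

lemma Omega_sq_2_least:
  assumes "\<And>\<eta>. \<eta> \<in> rank_states 2 \<Longrightarrow> (cmod (braket \<eta> \<psi>))\<^sup>2 \<le> M"
  shows "Omega_sq 2 \<psi> \<le> M"
  unfolding Omega_sq_def by (rule cSUP_least[OF rank_states_2_nonempty assms])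

lemma Omega_sq_2_nonneg:
  assumes "normalized \<psi>"
  shows "0 \<le> Omega_sq 2 \<psi>"
proof -
  obtain \<eta> :: "'a state" where "\<eta> \<in> rank_states 2" using rank_states_2_nonempty by blast
  from Omega_sq_upper[OF assms this] show ?thesis using zero_le_power2 order_trans by blast
qed

text \<open>Testing against the projection of \<open>\<psi>\<close> onto the span of \<open>\<alpha>\<close> and \<open>\<gamma>\<close>.\<close>

lemma Omega_sq_2_ge_contract:
  fixes \<psi> :: "'d::finite state"
  assumes "normalized \<psi>" "norm \<alpha> = 1" "norm \<gamma> = 1" "braket \<alpha> \<gamma> = 0"
  shows "(norm (contract P \<alpha> \<psi>))\<^sup>2 + (norm (contract P \<gamma> \<psi>))\<^sup>2 \<le> Omega_sq 2 \<psi>"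
proof -
  define \<nu> where "\<nu> = bitensor P \<alpha> (contract P \<alpha> \<psi>)"
  define \<mu> where "\<mu> = bitensor P \<gamma> (contract P \<gamma> \<psi>)"
  define s where "s = (norm (contract P \<alpha> \<psi>))\<^sup>2 + (norm (contract P \<gamma> \<psi>))\<^sup>2"
  have "braket \<nu> \<mu> = 0"
    by (simp add: \<nu>_def \<mu>_def braket_bitensor contract_bitensor assms) (simp add: braket_def)
  then have norm: "(norm (\<nu> + \<mu>))\<^sup>2 = s"
    by (simp add: norm_add_sq_orthogonal \<nu>_def \<mu>_def norm_sq_bitensor assms s_def)
  have s: "braket (\<nu> + \<mu>) \<psi> = of_real s"
    by (simp add: braket_add_left \<nu>_def \<mu>_def braket_bitensor braket_self s_def)
  have sep: "separable_wrt P \<nu>" "separable_wrt P \<mu>"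
    by (auto simp: separable_wrt_def \<nu>_def \<mu>_def)
  show ?thesis
  \<comment> \<open>The number \<open>s\<close> is both the squared norm of the projection and its
    overlap with \<psi>. If it vanishes, the projection cannot be normalized; otherwise the
    normalized projection has squared overlap \<open>s\<close>.\<close>
  proof (cases "s = 0")
    case True
    then show ?thesis using Omega_sq_2_nonneg[OF assms(1)] by (simp add: s_def)
  next
    case False
    then have pos: "s > 0" unfolding s_def
      by (metis add_nonneg_nonneg order_less_le zero_le_power2)
    have ns: "norm (\<nu> + \<mu>) = sqrt s" using norm by (metis norm_ge_zero real_sqrt_unique)
    define c where "c = inverse (sqrt s)"
    have "normalized (c *\<^sub>R (\<nu> + \<mu>))"
      using pos by (simp add: normalized_def ns c_def)
    then have "c *\<^sub>R (\<nu> + \<mu>) \<in> rank_states 2"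
      unfolding rank_states_2_iff scaleR_add_right using sep separable_wrt_scaleR by blast
    from Omega_sq_upper[OF assms(1) this]
    have "(c * s)\<^sup>2 \<le> Omega_sq 2 \<psi>"
      by (simp add: braket_scaleR_left s norm_mult power_mult_distrib)
    moreover have "(c * s)\<^sup>2 = s"
      using pos by (simp add: c_def power_mult_distrib power_inverse) (simp add: power2_eq_square)
    ultimately show ?thesis by (simp add: s_def)
  qed
qed

section \<open>Averaging over a basis\<close>

lemma contract_axis: "contract P (axis i 1) \<psi> $ y = \<psi> $ place P i y"
  by (simp add: contract_def axis_mult)

text \<open>The squared moduli of all amplitudes, grouped by the index of one particle.\<close>

lemma sum_norm_sq_contract:
  fixes \<psi> :: "'d::finite state"
  assumes "normalized \<psi>"
  shows "(\<Sum>i\<in>UNIV. (norm (contract P (axis i 1) \<psi>))\<^sup>2) = 1"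
proof -
  have "(\<Sum>i\<in>UNIV. (norm (contract P (axis i 1) \<psi>))\<^sup>2) = (norm \<psi>)\<^sup>2"
    by (simp add: norm_sq_vec sum_place[of _ P] contract_axis)
  then show ?thesis using assms by (simp add: normalized_def)
qed

lemma norm_sq_contract_axis:
  "of_real ((norm (contract P (axis i 1) \<psi>))\<^sup>2) = reduced P \<psi> $ i $ i"
  unfolding braket_self[symmetric]
  by (simp add: braket_def contract_axis reduced_def mult.commute)

text \<open>Sum \<open>f i + f j <= Omega_sq 2 \<psi>\<close> over the \<open>d - 1\<close> indices
  \<open>j\<close> other than \<open>i\<close>; those \<open>f j\<close> add up to
  \<open>1 - f i\<close>.\<close>

lemma Omega_sq_2_axis_bound:
  fixes \<psi> :: "'d::finite state"
  assumes "normalized \<psi>"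
  shows "(real CARD('d) - 2) * (norm (contract P (axis i 1) \<psi>))\<^sup>2 + 1
    \<le> (real CARD('d) - 1) * Omega_sq 2 \<psi>"
proof -
  define f where "f i = (norm (contract P (axis i 1) \<psi>))\<^sup>2" for i
  have "(\<Sum>j\<in>UNIV - {i}. f i + f j) \<le> (\<Sum>j\<in>UNIV - {i}. Omega_sq 2 \<psi>)"
    unfolding f_def
    by (intro sum_mono Omega_sq_2_ge_contract assms) (auto simp: braket_axis, simp add: axis_def)
  moreover have "(\<Sum>j\<in>UNIV - {i}. f j) = 1 - f i"
    using sum_norm_sq_contract[OF assms, of P] by (simp add: sum_diff1 f_def)
  moreover have "CARD('d) \<ge> 1" by (simp add: Suc_leI)
  ultimately show ?thesis
    by (simp add: sum.distrib card_Diff_singleton f_def algebra_simps)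
qed

lemma Omega_sq_2_ge:
  fixes \<psi> :: "'d::finite state"
  assumes "normalized \<psi>" "CARD('d) \<noteq> 1"
  shows "2 / CARD('d) \<le> Omega_sq 2 \<psi>"
proof -
  define d where "d = real CARD('d)"
  have "CARD('d) > 0" by simp
  then have d: "d \<ge> 2" unfolding d_def using assms(2) by linarith
  have "(\<Sum>i\<in>(UNIV :: 'd set). (d - 2) * (norm (contract A_BC (axis i 1) \<psi>))\<^sup>2 + 1)
      \<le> (\<Sum>i\<in>(UNIV :: 'd set). (d - 1) * Omega_sq 2 \<psi>)"
    unfolding d_def by (intro sum_mono Omega_sq_2_axis_bound assms)
  then have "(d - 2) + d \<le> d * ((d - 1) * Omega_sq 2 \<psi>)"
    by (simp add: sum.distrib sum_distrib_left[symmetric] sum_norm_sq_contract[OF assms(1)]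
        d_def[symmetric])
  \<comment> \<open>The summed bound has the factor \<open>d - 1\<close> on both sides; it is
    positive since dimension 1 is excluded.\<close>
  then have "(d - 1) * 2 \<le> (d - 1) * (d * Omega_sq 2 \<psi>)" by (simp add: algebra_simps)
  then have "2 \<le> d * Omega_sq 2 \<psi>" by (rule mult_left_le_imp_le) (use d in simp)
  then show ?thesis using d by (simp add: d_def[symmetric] divide_le_eq mult.commute)
qed

lemma reduced_hermitian: "reduced P \<psi> $ j $ i = cnj (reduced P \<psi> $ i $ j)"
  by (simp add: reduced_def mult.commute)

lemma mixed_of_Omega_sq_2_le:
  fixes \<psi> :: "'d::finite state"
  assumes "normalized \<psi>" "CARD('d) \<ge> 3" "Omega_sq 2 \<psi> \<le> 2 / CARD('d)"
  shows "maximally_mixed (reduced P \<psi>)"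
proof -
  define d where "d = real CARD('d)"
  have d: "d \<ge> 3" using assms(2) by (simp add: d_def)
  define f where "f i = (norm (contract P (axis i 1) \<psi>))\<^sup>2" for i
  \<comment> \<open>The axis bound with \<open>Omega_sq 2 \<psi>\<close> at most
    \<open>2 / d\<close>; the factor \<open>d - 2\<close> is positive and cancels.\<close>
  have le: "f i \<le> 1 / d" for i
  proof -
    have "(d - 2) * f i + 1 \<le> (d - 1) * Omega_sq 2 \<psi>"
      unfolding f_def d_def by (rule Omega_sq_2_axis_bound[OF assms(1)])
    also have "\<dots> \<le> (d - 1) * (2 / d)"
      using assms(3) d by (intro mult_left_mono) (auto simp: d_def)
    also have "\<dots> = (d - 2) * (1 / d) + 1"
      using d by (simp add: field_simps)
    finally have "(d - 2) * f i \<le> (d - 2) * (1 / d)" by simp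
    then show ?thesis by (rule mult_left_le_imp_le) (use d in simp)
  qed
  \<comment> \<open>Nonnegative terms with sum zero all vanish.\<close>
  have "(\<Sum>i\<in>UNIV. 1 / d - f i) = 0"
    using d sum_norm_sq_contract[OF assms(1), of P]
    by (simp add: sum_subtractf f_def d_def[symmetric])
  then have f: "f i = 1 / d" for i
    using le by (subst (asm) sum_nonneg_eq_0_iff) auto
  have diag: "reduced P \<psi> $ i $ i = of_real (1 / d)" for i
    by (simp only: norm_sq_contract_axis[symmetric] f[unfolded f_def])
  have off: "reduced P \<psi> $ i $ j = 0" if "i \<noteq> j" for i j
  proof -
    \<comment> \<open>A third basis vector exists because the dimension is at least 3.\<close>
    have "\<exists>k. k \<notin> {i, j}"
    proof (rule ccontr)
      assume "\<nexists>k. k \<notin> {i, j}"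
      then have "UNIV = {i, j}" by blast
      then have "CARD('d) = card {i, j}" by simp
      then show False using assms(2) that by simp
    qed
    then obtain k where k: "k \<noteq> i" "k \<noteq> j" by blast
    have Re0: "Re (\<omega> * reduced P \<psi> $ i $ j) \<le> 0" if \<omega>: "cmod \<omega> = 1" for \<omega>
    proof -
      define u :: "complex ^ 'd" where
        "u = (1 / sqrt 2) *\<^sub>R (\<chi> l. if l = i then 1 else if l = j then \<omega> else 0)"
      have ww: "cnj \<omega> * \<omega> = 1" using \<omega> complex_norm_square[of \<omega>] by (simp add: mult.commute)
      have u: "u $ l = (if l = i then 1 / sqrt 2 else if l = j then \<omega> / sqrt 2 else 0)" for l
        by (simp add: u_def scaleR_conv_of_real[where 'a = complex])
      have two: "complex_of_real (sqrt 2) * complex_of_real (sqrt 2) = 2"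
        by (simp flip: of_real_mult)
      have sum2: "(\<Sum>l\<in>UNIV. h l) = h i + h j"
        if "\<And>l. l \<noteq> i \<Longrightarrow> l \<noteq> j \<Longrightarrow> h l = 0" for h :: "'d \<Rightarrow> complex"
      proof -
        have "(\<Sum>l\<in>UNIV. h l) = (\<Sum>l\<in>{i, j}. h l)"
          by (rule sum.mono_neutral_right) (use that in auto)
        then show ?thesis using \<open>i \<noteq> j\<close> by simp
      qed
      have "braket u u = 1"
        unfolding braket_def
        by (subst sum2) (use \<open>i \<noteq> j\<close> in \<open>auto simp: u two ww\<close>)
      then have "of_real ((norm u)\<^sup>2) = complex_of_real 1" by (simp only: braket_self of_real_1)
      then have "(norm u)\<^sup>2 = 1" unfolding of_real_eq_iff .
      then have nu: "norm u = 1" by (metis norm_ge_zero real_sqrt_one real_sqrt_unique)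
      have "braket (axis k 1) u = 0" using k by (simp add: braket_axis u)
      then have "f k + (norm (contract P u \<psi>))\<^sup>2 \<le> Omega_sq 2 \<psi>"
        unfolding f_def by (intro Omega_sq_2_ge_contract assms nu) simp_all
      then have fu: "(norm (contract P u \<psi>))\<^sup>2 \<le> 1 / d"
        \<comment> \<open>The third vector already takes \<open>1 / d\<close> of the available
          \<open>2 / d\<close>.\<close>
        using f[of k] assms(3) by (simp add: d_def[symmetric])
      have "complex_of_real ((norm (contract P u \<psi>))\<^sup>2) =
          (reduced P \<psi> $ i $ i + \<omega> * reduced P \<psi> $ i $ j +
            cnj \<omega> * reduced P \<psi> $ j $ i + cnj \<omega> * \<omega> * reduced P \<psi> $ j $ j) / 2"
      proof -
        have "(\<Sum>m\<in>UNIV. cnj (u $ l) * u $ m * reduced P \<psi> $ l $ m) =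
            cnj (u $ l) * u $ i * reduced P \<psi> $ l $ i +
            cnj (u $ l) * u $ j * reduced P \<psi> $ l $ j" for l
          by (rule sum2) (simp add: u)
        moreover have "(\<Sum>l\<in>UNIV. cnj (u $ l) * u $ i * reduced P \<psi> $ l $ i +
              cnj (u $ l) * u $ j * reduced P \<psi> $ l $ j) =
            (cnj (u $ i) * u $ i * reduced P \<psi> $ i $ i +
              cnj (u $ i) * u $ j * reduced P \<psi> $ i $ j) +
            (cnj (u $ j) * u $ i * reduced P \<psi> $ j $ i +
              cnj (u $ j) * u $ j * reduced P \<psi> $ j $ j)"
          by (rule sum2) (simp add: u)
        ultimately show ?thesis
          unfolding norm_sq_contract using \<open>i \<noteq> j\<close>
          by (simp add: u two add_divide_distrib)
      qed
      \<comment> \<open>The diagonal terms give \<open>1 / d\<close>; by hermiticity the two cross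
        terms are conjugate and add up to twice a real part.\<close>
      also have "\<dots> = of_real (1 / d + Re (\<omega> * reduced P \<psi> $ i $ j))"
        unfolding diag ww reduced_hermitian[of P \<psi> j i]
        by (simp add: complex_eq_iff)
      finally have "(norm (contract P u \<psi>))\<^sup>2 = 1 / d + Re (\<omega> * reduced P \<psi> $ i $ j)"
        unfolding of_real_eq_iff .
      then show ?thesis using fu by simp
    qed
    \<comment> \<open>The phases 1 and -1 kill the real part of the entry, the phases \<i> and -\<i>
      its imaginary part.\<close>
    show ?thesis
      using Re0[of 1] Re0[of "-1"] Re0[of \<i>] Re0[of "-\<i>"] by (simp add: complex_eq_iff)
  qed
  show ?thesis
    unfolding maximally_mixed_def
    using diag off by (simp add: vec_eq_iff mat_def d_def)
qed

section \<open>Maximizers\<close>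

text \<open>The witness is the GHZ state.\<close>

lemma AME_exists: "\<exists>\<psi> :: 'd::finite state. AME \<psi>"
proof -
  define c where "c = complex_of_real (1 / sqrt CARD('d))"
  define g :: "'d state" where "g = (\<chi> i. case i of (x, y, z) \<Rightarrow> if x = y \<and> y = z then c else 0)"
  \<comment> \<open>The state is invariant under permuting the particles, so one formula covers all
    bipartitions.\<close>
  have g: "g $ place P x y = (if y = (x, x) then c else 0)" for P x y
    by (cases P; cases y) (auto simp: g_def)
  have cc: "c * cnj c = 1 / of_nat CARD('d)"
    by (simp add: c_def flip: of_real_mult)
  have "reduced P g = mat (1 / of_nat CARD('d))" for P
  proof -
    have "reduced P g $ i $ j = (\<Sum>y\<in>UNIV.
        if y = (i, i) then (if i = j then 1 / of_nat CARD('d) else 0) else 0)" for i j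
      unfolding reduced_def vec_lambda_beta by (intro sum.cong refl) (simp add: g cc)
    then show ?thesis by (simp add: vec_eq_iff mat_def)
  qed
  moreover have "normalized g"
  proof -
    have "(norm g)\<^sup>2 = (\<Sum>x\<in>(UNIV :: 'd set). (cmod c)\<^sup>2)"
      by (simp add: norm_sq_vec sum_place[of _ A_BC] g
          if_distrib[of "\<lambda>z. (cmod z)\<^sup>2"] cong: if_cong
          del: place.simps)
    also have "\<dots> = 1" by (simp add: c_def norm_divide power_divide)
    finally show ?thesis unfolding normalized_def
      by (metis norm_ge_zero real_sqrt_one real_sqrt_unique)
  qed
  ultimately show ?thesis by (auto simp: AME_iff maximally_mixed_def)
qed

text \<open>The upper bound for AME states meets the lower bound valid for all normalized
  states.\<close>

lemma Omega_sq_2_AME: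
  fixes \<psi> :: "'d::finite state"
  assumes "AME \<psi>" "CARD('d) \<noteq> 1"
  shows "Omega_sq 2 \<psi> = 2 / CARD('d)"
  using Omega_sq_2_least[OF AME_overlap_le[OF assms(1)]] Omega_sq_2_ge[OF _ assms(2)] assms(1)
  by (meson AME_iff antisym)

lemma maximizes_G2_iff:
  fixes \<psi> :: "'d::finite state"
  shows "maximizes_G2 \<psi> \<longleftrightarrow>
    normalized \<psi> \<and> (\<forall>\<phi> :: 'd state. normalized \<phi> \<longrightarrow> Omega_sq 2 \<psi> \<le> Omega_sq 2 \<phi>)"
  by (simp add: maximizes_G2_def geometric_measure_def)

section \<open>Local dimension one\<close>

lemma card_1_separable:
  assumes "CARD('d) = 1"
  shows "separable_wrt P (\<nu> :: 'd::finite state)"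
proof -
  obtain a where a: "(UNIV :: 'd set) = {a}" using assms by (auto simp: card_1_singleton_iff)
  then have "x = a" for x by blast
  \<comment> \<open>The factor \<open>1\<close> is the vector with all entries one.\<close>
  then have "\<nu> = bitensor P 1 (\<chi> y. \<nu> $ place P a y)"
    by (simp add: state_eq_iff[of _ _ P]) metis
  then show ?thesis unfolding separable_wrt_def by blast
qed

text \<open>The reduced matrices are 1 by 1, and their only entry is the squared norm of
  \<psi>.\<close>

lemma card_1_AME:
  assumes "CARD('d) = 1" "normalized (\<psi> :: 'd::finite state)"
  shows "AME \<psi>"
proof -
  obtain a where a: "(UNIV :: 'd set) = {a}" using assms by (auto simp: card_1_singleton_iff)
  then have eq: "x = a" for x by blast
  have "reduced P \<psi> $ a $ a = 1" for P
    using sum_norm_sq_contract[OF assms(2), of P] norm_sq_contract_axis[of P a \<psi>] by (simp add: a)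
  then have "reduced P \<psi> = mat 1" for P
    by (simp add: vec_eq_iff mat_def) (metis eq)
  then show ?thesis using assms by (simp add: AME_iff maximally_mixed_def)
qed

text \<open>Every state lies in \<open>rank_states 2\<close> and overlaps fully with itself, so the
  supremum is 1 for all of them.\<close>

lemma card_1_maximizes:
  assumes "CARD('d) = 1" "normalized (\<psi> :: 'd::finite state)"
  shows "maximizes_G2 \<psi>"
proof -
  have "Omega_sq 2 \<psi> \<le> Omega_sq 2 \<phi>" if "normalized \<phi>" for \<phi> :: "'d state"
  proof -
    have "\<phi> \<in> rank_states 2"
      unfolding rank_states_2_iff
      using that card_1_separable[OF assms(1)] by (metis add_0_right)
    from Omega_sq_upper[OF that this] have "1 \<le> Omega_sq 2 \<phi>"
      using that by (simp add: braket_self normalized_def)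
    moreover have "Omega_sq 2 \<psi> \<le> 1"
      by (rule Omega_sq_2_least) (rule overlap_le_1[OF assms(2)])
    ultimately show ?thesis by simp
  qed
  then show ?thesis using assms by (simp add: maximizes_G2_iff)
qed

theorem mainTheorem2:
  fixes \<psi> :: "'d::finite state"
  assumes "normalized \<psi>"
  shows "(CARD('d) \<noteq> 2 \<longrightarrow> (maximizes_G2 \<psi> \<longleftrightarrow> AME \<psi>)) \<and>
         (CARD('d) \<noteq> 1 \<longrightarrow> AME \<psi> \<longrightarrow> Omega_sq 2 \<psi> = 2 / real CARD('d))"
proof (cases "CARD('d) = 1")
  case True
  then show ?thesis using card_1_AME card_1_maximizes assms by blast
next
  case False
  have AME_max: "maximizes_G2 \<psi>" if "AME \<psi>"
    unfolding maximizes_G2_iff Omega_sq_2_AME[OF that False]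
    using assms Omega_sq_2_ge[OF _ False] by blast
  have max_AME: "AME \<psi>" if "CARD('d) \<noteq> 2" "maximizes_G2 \<psi>"
  proof -
    \<comment> \<open>Comparison with one AME state bounds the supremum of any maximizer by
      \<open>2 / d\<close>.\<close>
    obtain g :: "'d state" where g: "AME g" using AME_exists by blast
    then have "Omega_sq 2 \<psi> \<le> Omega_sq 2 g"
      using that(2) by (simp add: maximizes_G2_iff AME_iff)
    also have "\<dots> = 2 / CARD('d)" by (rule Omega_sq_2_AME[OF g False])
    finally have le: "Omega_sq 2 \<psi> \<le> 2 / CARD('d)" .
    have "CARD('d) > 0" by simp
    then have "CARD('d) \<ge> 3" using False that(1) by linarith
    then show ?thesis
      unfolding AME_iff using assms mixed_of_Omega_sq_2_le[OF assms _ le] by blast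
  qed
  show ?thesis using AME_max max_AME Omega_sq_2_AME[OF _ False] by blast
qed

end
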